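(* Let $n$ be a positive integer, let $I$ be a down-set of $(\mathrm{Par}_n^*,\preceq)$ with set of maximal elements $\max(I)=\{\lambda_1,\ldots,\lambda_k\}$, and let $M=\mathfrak{S}_n\cup\bigsqcup_{\lambda\in I}J_\lambda$ be its corresponding submonoid of $T\mathfrak{S}_n$ containing $\mathfrak{S}_n$. For each $i\in[k]=\{1,\ldots,k\}$, fix an idempotent $h_i\in\mathcal{P}_n$ such that $\|h_i\|=\lambda_i$. Then $M$ is generated, as a monoid, by the simple transpositions $s_1,\ldots,s_{n-1}$ together with the idempotents $h_1,\ldots,h_k$.
   Context: Let $[n]=\{1,\ldots,n\}$ and let $\mathfrak{S}_n$ be the symmetric group of permutations of $[n]$ (product = composition); $s_i$ denotes the simple transposition interchanging $i$ and $i+1$. Let $\mathcal{P}_n$ be the set of set partitions of $[n]$, ordered by refinement ($d\le e$ if every block of $d$ is contained in a block of $e$), regarded as a commutative idempotent monoid with product $de=d\vee e$ (supremum); its identity is the partition into singletons. The group $\mathfrak{S}_n$ acts on $\mathcal{P}_n$ by $s\cdot\{I_1,\ldots,I_k\}=\{s(I_1),\ldots,s(I_k)\}$. The tied-symmetric monoid is the semidirect product $T\mathfrak{S}_n=\mathcal{P}_n\rtimes\mathfrak{S}_n$: its elements are uniquely written $es$ with $e\in\mathcal{P}_n$, $s\in\mathfrak{S}_n$, with multiplication $(es)(e's')=\bigl(e\,(s\cdot e')\bigr)(ss')$. Both $\mathcal{P}_n$ and $\mathfrak{S}_n$ are regarded as submonoids of $T\mathfrak{S}_n$. $\mathrm{Par}_n$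 is the set of integer partitions of $n$ (weakly decreasing sequences of positive integers with sum $n$), and $\mathrm{Par}_n^*=\mathrm{Par}_n\setminus\{(1,\ldots,1)\}$. The type $\|e\|\in\mathrm{Par}_n$ of $e\in\mathcal{P}_n$ is the integer partition formed by the block sizes of $e$ in non-increasing order. For $\lambda,\lambda'\in\mathrm{Par}_n$, write $\lambda\preceq\lambda'$ if there exist $r\ge 1$ and $d_1,\ldots,d_r\in\mathcal{P}_n$ with $\|d_1\|=\cdots=\|d_r\|=\lambda'$ and $\|d_1\cdots d_r\|=\lambda$; this is known to be a partial order on $\mathrm{Par}_n$. A down-set is a subset $I$ such that $y\in I$ and $x\preceq y$ imply $x\in I$. For $\lambda\in\mathrm{Par}_n$, $J_\lambda=\{ses'\mid s,s'\in\mathfrak{S}_n\}\subseteq T\mathfrak{S}_n$, where $e\in\mathcal{P}_n$ is any fixed set partition with $\|e\|=\lambda$ (the set does not depend on the choice of $e$). These sets are the $\mathcal{J}$-classes of $T\mathfrak{S}_n$. The submonoid corresponding to a down-set $I$ of $(\mathrm{Par}_n^*,\preceq)$ is $\mathfrak{S}_n\cup\bigsqcup_{\lambda\in I}J_\lambda$. *)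

theory Defs
  imports "HOL.Hull" "HOL-Library.Multiset" "HOL-Library.Disjoint_Sets" "HOL-Algebra.Sym_Groups"
begin

section \<open>The monoid of set partitions\<close>

definition set_partitions :: "nat \<Rightarrow> nat set set set" where
  "set_partitions n = {e. partition_on {1..n} e}"

definition refinement_order :: "nat \<Rightarrow> nat set set gorder" where
  "refinement_order n = \<lparr>carrier = set_partitions n, eq = (=), le = refines {1..n}\<rparr>"

text \<open>The join below is defined by choice in the library; \<open>set_partition_join_least\<close> shows
  that the supremum it selects always exists.\<close>

definition partition_monoid :: "nat \<Rightarrow> nat set set monoid" where
  "partition_monoid n =
     \<lparr>carrier = set_partitions n,
      mult = (\<lambda>d e. d \<squnion>\<^bsub>refinement_order n\<^esub> e),
      one = (\<lambda>i. {i}) ` {1..n}\<rparr>"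

definition perm_act :: "(nat \<Rightarrow> nat) \<Rightarrow> nat set set \<Rightarrow> nat set set" where
  "perm_act s e = (\<lambda>B. s ` B) ` e"


section \<open>The tied-symmetric monoid\<close>

text \<open>The pair \<open>(e, s)\<close> stands for the product \<open>e s\<close>.\<close>

definition tied_sym_monoid :: "nat \<Rightarrow> (nat set set \<times> (nat \<Rightarrow> nat)) monoid" where
  "tied_sym_monoid n =
     \<lparr>carrier = set_partitions n \<times> carrier (sym_group n),
      mult = (\<lambda>(e, s) (e', s').
        (e \<otimes>\<^bsub>partition_monoid n\<^esub> perm_act s e', s \<otimes>\<^bsub>sym_group n\<^esub> s')),
      one = (\<one>\<^bsub>partition_monoid n\<^esub>, \<one>\<^bsub>sym_group n\<^esub>)\<rparr>"

definition of_partition :: "nat \<Rightarrow> nat set set \<Rightarrow> nat set set \<times> (nat \<Rightarrow> nat)" where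
  "of_partition n e = (e, \<one>\<^bsub>sym_group n\<^esub>)"

definition of_perm :: "nat \<Rightarrow> (nat \<Rightarrow> nat) \<Rightarrow> nat set set \<times> (nat \<Rightarrow> nat)" where
  "of_perm n s = (\<one>\<^bsub>partition_monoid n\<^esub>, s)"

definition monoid_generated :: "('a, 'b) monoid_scheme \<Rightarrow> 'a set \<Rightarrow> 'a set" where
  "monoid_generated G A = (\<lambda>H. submonoid H G) hull A"


section \<open>Types of set partitions and their order\<close>

definition Par :: "nat \<Rightarrow> nat list set" where
  "Par n = {xs. sorted_wrt (\<ge>) xs \<and> 0 \<notin> set xs \<and> sum_list xs = n}"

definition Par_star :: "nat \<Rightarrow> nat list set" where
  "Par_star n = Par n - {replicate n 1}"

definition ptype :: "nat set set \<Rightarrow> nat list" where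
  "ptype e = rev (sorted_list_of_multiset (image_mset card (mset_set e)))"

definition type_le :: "nat \<Rightarrow> nat list \<Rightarrow> nat list \<Rightarrow> bool" where
  "type_le n l l' \<longleftrightarrow> l \<in> Par n \<and> l' \<in> Par n \<and>
     (\<exists>ds. ds \<noteq> [] \<and> set ds \<subseteq> set_partitions n \<and> (\<forall>d\<in>set ds. ptype d = l') \<and>
       ptype (foldr (\<otimes>\<^bsub>partition_monoid n\<^esub>) ds \<one>\<^bsub>partition_monoid n\<^esub>) = l)"

definition is_down_set :: "nat \<Rightarrow> nat list set \<Rightarrow> bool" where
  "is_down_set n I \<longleftrightarrow> I \<subseteq> Par_star n \<and>
     (\<forall>y\<in>I. \<forall>x\<in>Par_star n. type_le n x y \<longrightarrow> x \<in> I)"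

definition maximal_types :: "nat \<Rightarrow> nat list set \<Rightarrow> nat list set" where
  "maximal_types n I = {x \<in> I. \<forall>y\<in>I. type_le n x y \<longrightarrow> y = x}"


section \<open>The submonoid of a down-set\<close>

definition J_class :: "nat \<Rightarrow> nat list \<Rightarrow> (nat set set \<times> (nat \<Rightarrow> nat)) set" where
  "J_class n l =
     (let e = (SOME e. e \<in> set_partitions n \<and> ptype e = l) in
      {of_perm n s \<otimes>\<^bsub>tied_sym_monoid n\<^esub> of_partition n e \<otimes>\<^bsub>tied_sym_monoid n\<^esub> of_perm n s' | s s'.
         s \<in> carrier (sym_group n) \<and> s' \<in> carrier (sym_group n)})"

definition down_set_submonoid :: "nat \<Rightarrow> nat list set \<Rightarrow> (nat set set \<times> (nat \<Rightarrow> nat)) set" where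
  "down_set_submonoid n I = of_perm n ` carrier (sym_group n) \<union> (\<Union>l\<in>I. J_class n l)"


section \<open>Well-definedness of the products\<close>

lemma set_partition_join_least:
  assumes "d \<in> set_partitions n" "e \<in> set_partitions n"
  shows "least (refinement_order n) (d \<squnion>\<^bsub>refinement_order n\<^esub> e) (Upper (refinement_order n) {d, e})"
proof -
  define U where "U = {f. refines {1..n} d f \<and> refines {1..n} e f}"
  have U: "Upper (refinement_order n) {d, e} = U"
    using assms by (auto simp: Upper_def refinement_order_def U_def set_partitions_def refines_def)
  have top: "(if n = 0 then {} else {{1..n}}) \<in> U"
    using assms
    by (auto simp: U_def refines_def set_partitions_def partition_on_def disjoint_def)
  have part: "\<And>P. P \<in> U \<Longrightarrow> partition_on {1..n} P"
    by (auto simp: U_def refines_def)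
  have ne: "U \<noteq> {}" using top by auto
  have "common_refinement U \<in> U"
    using common_refinement_coarsest[OF part _ _ ne] assms
    by (auto simp: U_def set_partitions_def)
  moreover have "\<And>P. P \<in> U \<Longrightarrow> refines {1..n} (common_refinement U) P"
    by (rule refines_common_refinement[OF part])
  ultimately have "least (refinement_order n) (common_refinement U) U"
    using part by (auto simp: least_def refinement_order_def set_partitions_def)
  then show ?thesis
    unfolding join_def sup_def U by (rule someI)
qed

lemma set_partition_mult_iff:
  assumes "d \<in> set_partitions n" "e \<in> set_partitions n"
  shows "refines {1..n} (d \<otimes>\<^bsub>partition_monoid n\<^esub> e) f \<longleftrightarrow> refines {1..n} d f \<and> refines {1..n} e f"
proof -
  have U: "Upper (refinement_order n) {d, e} = {f. refines {1..n} d f \<and> refines {1..n} e f}"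
    using assms by (auto simp: Upper_def refinement_order_def set_partitions_def refines_def)
  show ?thesis
    using set_partition_join_least[OF assms] unfolding U
    by (auto simp: least_def partition_monoid_def refinement_order_def intro: refines_trans)
qed

lemma set_partition_mult_closed:
  assumes "d \<in> set_partitions n" "e \<in> set_partitions n"
  shows "d \<otimes>\<^bsub>partition_monoid n\<^esub> e \<in> set_partitions n"
  using set_partition_join_least[OF assms]
  by (auto simp: least_def partition_monoid_def refinement_order_def Upper_def)

lemma set_partition_eqI:
  assumes "d \<in> set_partitions n" "e \<in> set_partitions n"
    and "\<And>f. refines {1..n} d f \<longleftrightarrow> refines {1..n} e f"
  shows "d = e"
  using assms by (metis mem_Collect_eq refines_asym refines_refl set_partitions_def)

lemma singletons_refine:
  "(\<lambda>i. {i}) ` {1..n} \<in> set_partitions n"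
  "e \<in> set_partitions n \<Longrightarrow> refines {1..n} ((\<lambda>i. {i}) ` {1..n}) e"
  by (auto simp: set_partitions_def refines_def partition_on_def disjoint_def)

lemma comm_monoid_partition_monoid: "comm_monoid (partition_monoid n)"
proof (rule comm_monoidI)
  have one: "\<one>\<^bsub>partition_monoid n\<^esub> = (\<lambda>i. {i}) ` {1..n}"
    and car: "carrier (partition_monoid n) = set_partitions n"
    by (simp_all add: partition_monoid_def)
  note facts = set_partition_mult_iff set_partition_mult_closed singletons_refine
  show "\<one>\<^bsub>partition_monoid n\<^esub> \<in> carrier (partition_monoid n)"
    using facts by (simp add: one car del: One_nat_def)
  fix x y z
  assume x: "x \<in> carrier (partition_monoid n)" and y: "y \<in> carrier (partition_monoid n)"
  show "x \<otimes>\<^bsub>partition_monoid n\<^esub> y \<in> carrier (partition_monoid n)"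
    using x y facts by (simp add: car del: One_nat_def)
  show "x \<otimes>\<^bsub>partition_monoid n\<^esub> y = y \<otimes>\<^bsub>partition_monoid n\<^esub> x"
    using x y by (intro set_partition_eqI[of _ n]) (auto simp: car facts simp del: One_nat_def)
  show "\<one>\<^bsub>partition_monoid n\<^esub> \<otimes>\<^bsub>partition_monoid n\<^esub> x = x"
    using x unfolding one car
    by (intro set_partition_eqI[of _ n])
       (auto simp: facts simp del: One_nat_def intro: refines_trans[OF singletons_refine(2)])
  assume z: "z \<in> carrier (partition_monoid n)"
  show "x \<otimes>\<^bsub>partition_monoid n\<^esub> y \<otimes>\<^bsub>partition_monoid n\<^esub> z =
        x \<otimes>\<^bsub>partition_monoid n\<^esub> (y \<otimes>\<^bsub>partition_monoid n\<^esub> z)"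
    using x y z by (intro set_partition_eqI[of _ n]) (auto simp: car facts simp del: One_nat_def)
qed

lemma perm_act_closed:
  assumes "s permutes {1..n}" "e \<in> set_partitions n"
  shows "perm_act s e \<in> set_partitions n"
proof -
  have i: "inj s" using assms(1) by (rule permutes_inj)
  have "\<Union> (perm_act s e) = s ` \<Union> e" by (auto simp: perm_act_def)
  then have "\<Union> (perm_act s e) = {1..n}"
    using assms permutes_image[OF assms(1)] by (simp add: set_partitions_def partition_on_def del: One_nat_def)
  then show ?thesis
    using assms(2) i unfolding set_partitions_def partition_on_def disjoint_def perm_act_def
    by (auto simp flip: image_Int simp: inj_image_mem_iff) blast+
qed

lemma perm_act_comp: "perm_act (s \<circ> t) e = perm_act s (perm_act t e)"
  by (simp add: perm_act_def image_image image_comp comp_def)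

lemma perm_act_id: "perm_act id e = e"
  by (simp add: perm_act_def)

lemma perm_act_mono:
  assumes "s permutes {1..n}" "refines {1..n} d e"
  shows "refines {1..n} (perm_act s d) (perm_act s e)"
proof -
  have "\<forall>X\<in>perm_act s d. \<exists>Y\<in>perm_act s e. X \<subseteq> Y"
    using assms(2) by (simp add: refines_def perm_act_def) (meson image_mono)
  then show ?thesis
    using assms perm_act_closed by (auto simp: refines_def set_partitions_def simp del: One_nat_def)
qed

lemma perm_act_refines_iff:
  assumes "s permutes {1..n}"
  shows "refines {1..n} (perm_act s d) f \<longleftrightarrow> refines {1..n} d (perm_act (inv_into UNIV s) f)"
proof -
  have "perm_act (inv_into UNIV s) (perm_act s d) = d" "perm_act s (perm_act (inv_into UNIV s) f) = f"
    using permutes_inv_o[OF assms] by (simp_all flip: perm_act_comp add: perm_act_id)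
  then show ?thesis
    using perm_act_mono[OF assms] perm_act_mono[OF permutes_inv[OF assms]] by metis
qed

lemma perm_act_mult:
  assumes "s permutes {1..n}" "d \<in> set_partitions n" "e \<in> set_partitions n"
  shows "perm_act s (d \<otimes>\<^bsub>partition_monoid n\<^esub> e) =
    perm_act s d \<otimes>\<^bsub>partition_monoid n\<^esub> perm_act s e"
  by (rule set_partition_eqI[of _ n])
     (use assms in \<open>auto simp: perm_act_closed set_partition_mult_closed set_partition_mult_iff
       perm_act_refines_iff simp del: One_nat_def\<close>)

lemma perm_act_one:
  assumes "s permutes {1..n}"
  shows "perm_act s \<one>\<^bsub>partition_monoid n\<^esub> = \<one>\<^bsub>partition_monoid n\<^esub>"
proof -
  have "perm_act s ((\<lambda>i. {i}) ` {1..n}) = (\<lambda>i. {i}) ` (s ` {1..n})"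
    by (simp add: perm_act_def image_image)
  then show ?thesis
    using permutes_image[OF assms] by (simp add: partition_monoid_def del: One_nat_def)
qed

lemma monoid_tied_sym_monoid: "monoid (tied_sym_monoid n)"
proof -
  interpret P: comm_monoid "partition_monoid n" by (rule comm_monoid_partition_monoid)
  have car: "carrier (partition_monoid n) = set_partitions n"
    by (simp add: partition_monoid_def)
  note P = P.m_assoc[unfolded car] P.l_one[unfolded car] P.r_one[unfolded car]
    P.one_closed[unfolded car] P.m_closed[unfolded car]
  show ?thesis
    by (rule monoidI)
       (auto simp: tied_sym_monoid_def sym_group_def P perm_act_closed perm_act_mult perm_act_one
         perm_act_comp perm_act_id comp_assoc permutes_id permutes_compose simp del: One_nat_def)
qed

end

theory Submission
  imports Defs
begin

text \<open>
  Write \<open>M\<close> for the set of all pairs \<open>(e, s)\<close> in which \<open>e\<close> is the discrete partition or has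
  its type in the down-set \<open>I\<close>.  This is the submonoid attached to \<open>I\<close>: two set partitions of
  the same type are conjugate under the symmetric group (\<open>ptype_eq_imp_conjugate\<close>), so the
  \<open>J\<close>-class of a type consists of all \<open>(e, s)\<close> with \<open>e\<close> of that type
  (\<open>J_class_eq\<close>).

  The generated monoid lies in \<open>M\<close> because \<open>M\<close> is closed under products, and that is the one
  point which is not formal.  A down-set is only closed under joins of set partitions of
  \<^emph>\<open>equal\<close> type, and a coarsening of \<open>e\<close> need not have a type below that of \<open>e\<close>: a partition of
  type \<open>(3, 1, 1)\<close> has a coarsening of type \<open>(3, 2)\<close>, but joins of partitions of type
  \<open>(3, 1, 1)\<close> have no block of size two.
  For the join \<open>f\<close> of \<open>d\<close> and \<open>e\<close> it works out as follows.  Let \<open>A\<close> be a smallest nontrivial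
  block of \<open>d\<close> and \<open>e\<close> taken together, say a block of \<open>e\<close>.  Every nontrivial block of \<open>f\<close> contains a
  nontrivial block of \<open>d\<close> or of \<open>e\<close> (\<open>nontrivial_block_of_mult\<close>), hence has at least \<open>|A|\<close>
  elements.  So inside \<open>f\<close> the block \<open>A\<close> can be moved into any nontrivial block of
  \<open>f\<close> that \<open>e\<close> splits into singletons.  Therefore any two elements of a block of \<open>f\<close>
  are joined by some conjugate of \<open>e\<close> refining \<open>f\<close>, and \<open>f\<close> is the join of all such conjugates
  (\<open>type_le_coarsening\<close>).

  Conversely, a submonoid containing the generators contains all permutations, as adjacent
  transpositions generate the symmetric group.  With a set partition it contains all
  conjugates, which settles the maximal types.  A type that is not
  maximal is that of a join of partitions of a different type in \<open>I\<close>; these have strictly more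
  blocks (\<open>type_le_length_less\<close>), so an induction on the number of blocks, starting from
  partitions with many blocks, reaches every partition with type in \<open>I\<close>.
\<close>

(* Intervals are written {1..n} throughout; rewriting 1 to Suc 0 would hide them from simp rules. *)
declare One_nat_def [simp del]

section \<open>Types of set partitions\<close>

lemma set_partitions_iff: "e \<in> set_partitions n \<longleftrightarrow> partition_on {1..n} e"
  by (simp add: set_partitions_def)

lemma finite_set_partition: "e \<in> set_partitions n \<Longrightarrow> finite e"
  unfolding set_partitions_iff by (rule finite_elements[rotated]) auto

lemma block_subset: "e \<in> set_partitions n \<Longrightarrow> B \<in> e \<Longrightarrow> B \<subseteq> {1..n}"
  by (auto simp: set_partitions_iff partition_on_def)

lemma finite_block: "e \<in> set_partitions n \<Longrightarrow> B \<in> e \<Longrightarrow> finite B"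
  by (rule finite_subset[OF block_subset]) auto

lemma block_nonempty: "e \<in> set_partitions n \<Longrightarrow> B \<in> e \<Longrightarrow> B \<noteq> {}"
  by (auto simp: set_partitions_iff partition_on_def)

lemma block_eqI:
  "e \<in> set_partitions n \<Longrightarrow> A \<in> e \<Longrightarrow> B \<in> e \<Longrightarrow> x \<in> A \<Longrightarrow> x \<in> B \<Longrightarrow> A = B"
  by (auto simp: set_partitions_iff partition_on_def disjoint_def)

lemma ex_block: "e \<in> set_partitions n \<Longrightarrow> x \<in> {1..n} \<Longrightarrow> \<exists>B\<in>e. x \<in> B"
  by (auto simp: set_partitions_iff partition_on_def)

lemma set_partition_one: "\<one>\<^bsub>partition_monoid n\<^esub> = (\<lambda>i. {i}) ` {1..n}"
  by (simp add: partition_monoid_def)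

lemma set_partition_one_closed: "\<one>\<^bsub>partition_monoid n\<^esub> \<in> set_partitions n"
  unfolding set_partition_one by (rule singletons_refine)

lemma mset_ptype: "mset (ptype e) = image_mset card (mset_set e)"
  by (simp add: ptype_def)

lemma set_ptype: "finite e \<Longrightarrow> set (ptype e) = card ` e"
  by (simp add: ptype_def)

lemma length_ptype: "length (ptype e) = card e"
  using arg_cong[OF mset_ptype, of size] by simp

lemma ptype_eq_iff: "ptype d = ptype e \<longleftrightarrow> image_mset card (mset_set d) = image_mset card (mset_set e)"
  using mset_ptype by (metis ptype_def)

lemma ptype_in_Par:
  assumes "e \<in> set_partitions n"
  shows "ptype e \<in> Par n"
proof -
  have "sum_list (ptype e) = (\<Sum>B\<in>e. card B)"
    using mset_ptype[of e] by (simp flip: sum_mset_sum_list add: sum_unfold_sum_mset)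
  also have "\<dots> = n"
    using product_partition[of "{1..n}" e] finite_block[OF assms] assms
    by (simp add: set_partitions_iff)
  finally have "sum_list (ptype e) = n" .
  moreover have "0 \<notin> set (ptype e)"
    using finite_block[OF assms] block_nonempty[OF assms]
    by (auto simp: set_ptype[OF finite_set_partition[OF assms]])
  moreover have "sorted_wrt (\<ge>) (ptype e)"
    by (simp add: ptype_def sorted_wrt_rev)
  ultimately show ?thesis by (simp add: Par_def)
qed

lemma ptype_one_iff:
  assumes "e \<in> set_partitions n"
  shows "ptype e = replicate n 1 \<longleftrightarrow> e = \<one>\<^bsub>partition_monoid n\<^esub>"
proof
  assume "ptype e = replicate n 1"
  then have c: "card B = 1" if "B \<in> e" for B
    using that set_ptype[OF finite_set_partition[OF assms]] by (auto split: if_splits)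
  show "e = \<one>\<^bsub>partition_monoid n\<^esub>"
    unfolding set_partition_one
  proof (intro equalityI subsetI)
    fix B assume "B \<in> e"
    then show "B \<in> (\<lambda>i. {i}) ` {1..n}"
      using c[of B] block_subset[OF assms, of B] by (auto elim!: card_1_singletonE)
  next
    fix B assume "B \<in> (\<lambda>i. {i}) ` {1..n}"
    then obtain i where i: "i \<in> {1..n}" "B = {i}" by auto
    then obtain C where "C \<in> e" "i \<in> C" using ex_block[OF assms] by blast
    then show "B \<in> e" using i c[of C] by (metis card_1_singletonE singletonD)
  qed
next
  assume "e = \<one>\<^bsub>partition_monoid n\<^esub>"
  then have e: "e = (\<lambda>i. {i}) ` {1..n}" by (simp add: set_partition_one)
  have "card e = n" unfolding e by (subst card_image) auto
  moreover have "\<forall>k\<in>set (ptype e). k = 1"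
    unfolding set_ptype[OF finite_set_partition[OF assms]] by (auto simp: e)
  ultimately show "ptype e = replicate n 1"
    using replicate_eqI[of "ptype e" n 1] by (simp add: length_ptype)
qed

lemma ptype_in_Par_star_iff:
  "e \<in> set_partitions n \<Longrightarrow> ptype e \<in> Par_star n \<longleftrightarrow> e \<noteq> \<one>\<^bsub>partition_monoid n\<^esub>"
  by (simp add: Par_star_def ptype_in_Par ptype_one_iff)

lemma ptype_perm_act:
  assumes "s permutes {1..n}"
  shows "ptype (perm_act s e) = ptype e"
proof -
  have i: "inj s" using assms by (rule permutes_inj)
  then have "inj_on ((`) s) e" by (simp add: inj_on_def inj_image_eq_iff)
  then have "mset_set (perm_act s e) = image_mset ((`) s) (mset_set e)"
    by (simp add: perm_act_def image_mset_mset_set)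
  moreover have "card (s ` B) = card B" for B
    using i by (simp add: card_image inj_on_subset)
  ultimately show ?thesis
    unfolding ptype_eq_iff by (simp add: multiset.map_comp comp_def)
qed

text \<open>
  Equal multisets of block sizes allow the blocks to be paired off one at a time; bijections
  between paired blocks glue, as blocks are disjoint.  The two families need not have the
  same union, which lets the induction remove one block from each.
\<close>

lemma bij_betw_matching_blocks:
  assumes "finite e" "finite e'" "disjoint e" "disjoint e'" "\<forall>B\<in>e \<union> e'. finite B"
    and "image_mset card (mset_set e) = image_mset card (mset_set e')"
  shows "\<exists>s. bij_betw s (\<Union>e) (\<Union>e') \<and> (`) s ` e = e'"
  using assms
proof (induction e arbitrary: e' rule: finite_induct)
  case empty
  then have "e' = {}" by (simp add: mset_set_empty_iff)
  then show ?case by (simp add: bij_betw_def)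
next
  case (insert X F)
  have "card X \<in># image_mset card (mset_set e')"
    using insert.prems(5) insert.hyps by (metis image_mset_add_mset mset_set.insert union_single_eq_member)
  then obtain Y where Y: "Y \<in> e'" "card X = card Y" using insert.prems(1) by auto
  have fin: "finite X" "finite Y" using insert.prems Y by auto
  have e': "mset_set e' = add_mset Y (mset_set (e' - {Y}))"
    using insert.prems(1) Y by (simp add: mset_set.remove)
  have "image_mset card (mset_set F) = image_mset card (mset_set (e' - {Y}))"
    using insert.prems(5) insert.hyps Y unfolding e' by simp
  moreover have "disjoint F" "disjoint (e' - {Y})" "\<forall>B\<in>F \<union> (e' - {Y}). finite B"
    using insert.prems by (auto simp: disjoint_def)
  ultimately obtain s where s: "bij_betw s (\<Union>F) (\<Union>(e' - {Y}))" "(`) s ` F = e' - {Y}"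
    using insert.IH[of "e' - {Y}"] insert.prems(1) by auto
  obtain g where g: "bij_betw g X Y"
    using finite_same_card_bij[OF fin Y(2)] by blast
  define t where "t x = (if x \<in> X then g x else s x)" for x
  have dX: "Z \<inter> X = {}" if "Z \<in> F" for Z
    using disjointD[OF insert.prems(2), of Z X] insert.hyps(2) that by auto
  have dY: "Z \<inter> Y = {}" if "Z \<in> e' - {Y}" for Z
    using disjointD[OF insert.prems(3), of Z Y] Y(1) that by auto
  have tX: "bij_betw t X Y"
    using g by (subst bij_betw_cong[where g = g]) (auto simp: t_def)
  have tF: "bij_betw t (\<Union>F) (\<Union>(e' - {Y}))"
    using s(1) dX by (subst bij_betw_cong[where g = s]) (auto simp: t_def)
  have "bij_betw t (X \<union> \<Union>F) (Y \<union> \<Union>(e' - {Y}))"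
    using tX tF by (rule bij_betw_combine) (use dY in auto)
  moreover have "Y \<union> \<Union>(e' - {Y}) = \<Union>e'" using Y by auto
  moreover have "t ` Z = s ` Z" if "Z \<in> F" for Z
    using dX[OF that] by (auto simp: t_def intro!: image_cong)
  then have "(`) t ` insert X F = e'"
    using s(2) tX Y by (auto simp: bij_betw_def)
  ultimately show ?case by auto
qed

lemma ptype_eq_imp_conjugate:
  assumes "d \<in> set_partitions n" "e \<in> set_partitions n" "ptype d = ptype e"
  obtains s where "s permutes {1..n}" "perm_act s d = e"
proof -
  have "\<forall>B\<in>d \<union> e. finite B"
    using finite_block[OF assms(1)] finite_block[OF assms(2)] by blast
  moreover have "disjoint d" "disjoint e"
    using assms(1,2) by (simp_all add: set_partitions_iff partition_on_def)
  ultimately obtain s where s: "bij_betw s (\<Union>d) (\<Union>e)" "(`) s ` d = e"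
    using bij_betw_matching_blocks[of d e] finite_set_partition[OF assms(1)]
      finite_set_partition[OF assms(2)] assms(3) ptype_eq_iff by blast
  have U: "\<Union>d = {1..n}" "\<Union>e = {1..n}"
    using assms by (auto simp: set_partitions_iff partition_on_def)
  define t where "t x = (if x \<in> {1..n} then s x else x)" for x
  have "bij_betw t {1..n} {1..n}"
    using s(1) unfolding U by (subst bij_betw_cong[where g = s]) (auto simp: t_def)
  then have "t permutes {1..n}" by (rule bij_imp_permutes) (auto simp: t_def)
  moreover have "t ` B = s ` B" if "B \<in> d" for B
    using block_subset[OF assms(1) that] by (auto simp: t_def intro!: image_cong)
  then have "perm_act t d = e" using s(2) by (simp add: perm_act_def)
  ultimately show ?thesis by (rule that)
qed

section \<open>Joins of several set partitions\<close>

lemma foldr_mult_closed: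
  "set ds \<subseteq> set_partitions n \<Longrightarrow>
    foldr (\<otimes>\<^bsub>partition_monoid n\<^esub>) ds \<one>\<^bsub>partition_monoid n\<^esub> \<in> set_partitions n"
  by (induction ds) (auto simp: set_partition_one_closed set_partition_mult_closed)

lemma foldr_mult_refines_iff:
  assumes "set ds \<subseteq> set_partitions n" "f \<in> set_partitions n"
  shows "refines {1..n} (foldr (\<otimes>\<^bsub>partition_monoid n\<^esub>) ds \<one>\<^bsub>partition_monoid n\<^esub>) f \<longleftrightarrow>
    (\<forall>d\<in>set ds. refines {1..n} d f)"
  using assms(1)
proof (induction ds)
  case Nil
  then show ?case using singletons_refine(2)[OF assms(2)] by (simp add: set_partition_one)
next
  case (Cons d ds)
  then show ?case by (simp add: set_partition_mult_iff foldr_mult_closed)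
qed

text \<open>
  Sending a block to the block containing it maps \<open>d\<close> onto \<open>e\<close>.  If the block counts agree, this
  map is injective, so no block of \<open>e\<close> absorbs two blocks of \<open>d\<close>.
\<close>

lemma refines_card:
  assumes "d \<in> set_partitions n" "refines {1..n} d e"
  shows "card e \<le> card d" and "card e = card d \<Longrightarrow> d = e"
proof -
  have e: "e \<in> set_partitions n" using assms by (simp add: refines_def set_partitions_iff)
  have "\<forall>X\<in>d. \<exists>Y\<in>e. X \<subseteq> Y" using assms by (simp add: refines_def)
  then obtain \<phi> where \<phi>: "\<And>X. X \<in> d \<Longrightarrow> \<phi> X \<in> e \<and> X \<subseteq> \<phi> X" by metis
  have surj: "\<phi> ` d = e"
  proof (intro equalityI subsetI)
    fix Y assume Y: "Y \<in> e"
    then obtain y where y: "y \<in> Y" using block_nonempty[OF e] by blast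
    then obtain X where X: "X \<in> d" "y \<in> X"
      using ex_block[OF assms(1)] block_subset[OF e Y] by blast
    then have "\<phi> X = Y" using \<phi>[OF X(1)] Y y block_eqI[OF e] by blast
    then show "Y \<in> \<phi> ` d" using X by auto
  qed (use \<phi> in auto)
  note fin = finite_set_partition[OF assms(1)]
  show "card e \<le> card d" using surj fin card_image_le by blast
  assume "card e = card d"
  then have inj: "inj_on \<phi> d" using surj fin by (simp add: eq_card_imp_inj_on)
  have "\<phi> X = X" if X: "X \<in> d" for X
  proof (rule ccontr)
    assume "\<phi> X \<noteq> X"
    then obtain y where y: "y \<in> \<phi> X" "y \<notin> X" using \<phi>[OF X] by blast
    then obtain Z where Z: "Z \<in> d" "y \<in> Z"
      using ex_block[OF assms(1)] block_subset[OF e] \<phi>[OF X] by blast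
    then have "\<phi> Z = \<phi> X" using \<phi>[OF Z(1)] \<phi>[OF X] y block_eqI[OF e] by blast
    then show False using inj X Z y by (auto dest: inj_onD)
  qed
  then show "d = e" using surj by auto
qed

text \<open>
  A member of the list refines the join; equal block counts would force it to be the join, and
  the types would coincide.  This makes the number of blocks a termination measure for
  climbing towards maximal types.
\<close>

lemma type_le_length_less:
  assumes "type_le n x y" "x \<noteq> y"
  shows "length x < length y"
proof -
  obtain ds where ds: "ds \<noteq> []" "set ds \<subseteq> set_partitions n" "\<forall>d\<in>set ds. ptype d = y"
    and x: "ptype (foldr (\<otimes>\<^bsub>partition_monoid n\<^esub>) ds \<one>\<^bsub>partition_monoid n\<^esub>) = x" (is "ptype ?g = x")
    using assms(1) by (auto simp: type_le_def)
  have g: "?g \<in> set_partitions n" using ds(2) by (rule foldr_mult_closed)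
  have d: "hd ds \<in> set ds" using ds(1) by simp
  have "refines {1..n} ?g ?g" using g by (simp add: set_partitions_iff refines_refl)
  then have "refines {1..n} (hd ds) ?g"
    using foldr_mult_refines_iff[OF ds(2) g] d by blast
  moreover have "hd ds \<noteq> ?g" using d ds(3) x assms(2) by metis
  ultimately have "card ?g < card (hd ds)"
    using refines_card[of "hd ds" n ?g] d ds(2) by fastforce
  then show ?thesis using d ds(3) x length_ptype by metis
qed

section \<open>Joins of set partitions of equal type\<close>

lemma perm_act_transpose_block:
  assumes "f \<in> set_partitions n" "B \<in> f" "x \<in> B" "y \<in> B"
  shows "perm_act (transpose x y) f = f"
proof -
  have "transpose x y ` C = C" if "C \<in> f" for C
  proof (cases "C = B")
    case False
    then have "x \<notin> C" "y \<notin> C" using block_eqI[OF assms(1)] assms that by blast+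
    then show ?thesis by simp
  qed (use assms in simp)
  then show ?thesis by (simp add: perm_act_def)
qed

lemma ex_permutes_image:
  assumes "finite A" "card A = card A'" "A \<inter> A' = {}" "A \<subseteq> S" "A' \<subseteq> S" "finite A'"
  obtains s where "s permutes S" "s ` A = A'" "\<And>x. x \<notin> A \<union> A' \<Longrightarrow> s x = x"
proof -
  obtain p where p: "bij_betw p A A'" using finite_same_card_bij[OF assms(1,6,2)] by blast
  let ?q = "inv_into A p"
  have q: "bij_betw ?q A' A" using p by (rule bij_betw_inv_into)
  define s where "s x = (if x \<in> A then p x else if x \<in> A' then ?q x else x)" for x
  have pA: "p x \<in> A' \<and> p x \<notin> A" if "x \<in> A" for x
    using bij_betwE[OF p] that assms(3) by auto
  have qA: "?q x \<in> A" if "x \<in> A'" for x using bij_betwE[OF q] that by auto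
  have ss: "s (s x) = x" for x
    using pA[of x] qA[of x] p bij_betw_inv_into_left[OF p] bij_betw_inv_into_right[OF p]
    by (auto simp: s_def)
  have "s ` S \<subseteq> S" using pA qA assms(4,5) by (auto simp: s_def)
  then have "bij_betw s S S" using ss by (intro bij_betw_byWitness[where f' = s]) auto
  then have "s permutes S" by (rule bij_imp_permutes) (use assms in \<open>auto simp: s_def\<close>)
  moreover have "s ` A = A'" using p by (auto simp: s_def bij_betw_def)
  ultimately show ?thesis using that by (auto simp: s_def)
qed

text \<open>
  If \<open>e\<close> splits \<open>B\<close> into singletons, then \<open>A\<close> is disjoint from \<open>B\<close>, and a permutation that carries
  \<open>A\<close> onto a subset of \<open>B\<close> and fixes every point outside these two sets only dissolves \<open>A\<close> and
  fuses singletons inside \<open>B\<close>; the result still refines \<open>f\<close>.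
\<close>

lemma conjugate_with_block_inside:
  assumes e: "e \<in> set_partitions n" and ref: "refines {1..n} e f"
    and A: "A \<in> e" "card A \<ge> 2" and B: "B \<in> f" "card A \<le> card B"
  obtains d C where "d \<in> set_partitions n" "ptype d = ptype e" "refines {1..n} d f"
    "C \<in> d" "C \<subseteq> B" "card C \<ge> 2"
proof (cases "\<exists>C\<in>e. C \<subseteq> B \<and> card C \<ge> 2")
  case True
  then show ?thesis using e ref that by blast
next
  case False
  have f: "f \<in> set_partitions n" using ref by (simp add: refines_def set_partitions_iff)
  have disj: "A \<inter> B = {}"
  proof -
    obtain Y where Y: "Y \<in> f" "A \<subseteq> Y" using ref A by (auto simp: refines_def)
    then have "Y \<noteq> B" using False A by blast
    then show ?thesis using Y B block_eqI[OF f] by blast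
  qed
  obtain A' where A': "A' \<subseteq> B" "card A' = card A" "finite A'"
    using B(2) by (meson obtain_subset_with_card_n)
  have sub: "A \<subseteq> {1..n}" "A' \<subseteq> {1..n}"
    using block_subset[OF e A(1)] block_subset[OF f B(1)] A' by auto
  obtain s where s: "s permutes {1..n}" "s ` A = A'" "\<And>x. x \<notin> A \<union> A' \<Longrightarrow> s x = x"
  proof (rule ex_permutes_image[of A A' "{1..n}"])
    show "A \<inter> A' = {}" using A' disj by blast
  qed (use A' sub finite_block[OF e A(1)] in auto)
  have "\<exists>Y\<in>f. s ` X \<subseteq> Y" if X: "X \<in> e" for X
  proof -
    consider "X = A" | "X \<noteq> A" "X \<inter> A' = {}" | "X \<noteq> A" "X \<inter> A' \<noteq> {}" by blast
    then show ?thesis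
    proof cases
      case 1
      then show ?thesis using s(2) A' B(1) by blast
    next
      case 2
      then have "X \<inter> A = {}" using block_eqI[OF e X A(1)] by blast
      then have "s ` X = X" using 2 s(3) by (auto simp: image_iff) (metis UnE disjoint_iff)+
      then show ?thesis using ref X by (auto simp: refines_def)
    next
      case 3
      obtain Y where Y: "Y \<in> f" "X \<subseteq> Y" using ref X by (auto simp: refines_def)
      then have "X \<subseteq> B" using 3 A' B(1) block_eqI[OF f] by blast
      then have "\<not> card X \<ge> 2" using False X by blast
      moreover have "card X \<noteq> 0" using finite_block[OF e X] block_nonempty[OF e X] by simp
      ultimately have "card X = 1" by linarith
      then obtain z where z: "X = {z}" by (auto elim: card_1_singletonE)
      then have "s z \<in> {1..n}" using permutes_in_image[OF s(1)] block_subset[OF e X] by auto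
      then show ?thesis using ex_block[OF f] z by auto
    qed
  qed
  then have "refines {1..n} (perm_act s e) f"
    using perm_act_closed[OF s(1) e] f unfolding refines_def set_partitions_iff
    by (auto simp: perm_act_def)
  moreover have "A' \<in> perm_act s e" using A s(2) by (auto simp: perm_act_def)
  ultimately show ?thesis
    using that[of "perm_act s e" A'] perm_act_closed[OF s(1) e] ptype_perm_act[OF s(1)] A' A by auto
qed

text \<open>
  Permutations of a single block \<open>B\<close> of \<open>f\<close> preserve \<open>f\<close>, hence the property of refining it, and can
  move a pair of elements joined inside \<open>B\<close> to any other pair in \<open>B\<close>.
\<close>

lemma conjugate_joining_pair:
  assumes e: "e \<in> set_partitions n" and ref: "refines {1..n} e f"
    and A: "A \<in> e" "card A \<ge> 2" and B: "B \<in> f" "card A \<le> card B"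
    and xy: "x \<in> B" "y \<in> B" "x \<noteq> y"
  obtains d C where "d \<in> set_partitions n" "ptype d = ptype e" "refines {1..n} d f"
    "C \<in> d" "x \<in> C" "y \<in> C"
proof -
  have f: "f \<in> set_partitions n" using ref by (simp add: refines_def set_partitions_iff)
  obtain d C where d: "d \<in> set_partitions n" "ptype d = ptype e" "refines {1..n} d f"
    and C: "C \<in> d" "C \<subseteq> B" "card C \<ge> 2"
    using conjugate_with_block_inside[OF e ref A B] by metis
  have "\<exists>u v. u \<in> C \<and> v \<in> C \<and> u \<noteq> v"
  proof (rule ccontr)
    assume "\<not> ?thesis"
    then have "card C \<le> 1" using finite_block[OF d(1) C(1)] by (simp add: card_le_Suc0_iff_eq One_nat_def)
    then show False using C by simp
  qed
  then obtain u v where uv: "u \<in> C" "v \<in> C" "u \<noteq> v" by blast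
  \<comment> \<open>The first transposition moves \<open>u\<close> to \<open>x\<close> and \<open>v\<close> to \<open>w \<noteq> x\<close>; the second then moves \<open>w\<close> to
    \<open>y\<close> without disturbing \<open>x\<close>.\<close>
  define w where "w = transpose u x v"
  have w: "w \<in> B" "w \<noteq> x"
    using uv C xy by (auto simp: w_def transpose_def)
  define s where "s = transpose w y \<circ> transpose u x"
  have s: "s u = x" "s v = y"
    using w xy uv by (auto simp: s_def w_def)
  have B': "B \<subseteq> {1..n}" using block_subset[OF f B(1)] .
  then have perm: "s permutes {1..n}"
    unfolding s_def using w xy uv C by (intro permutes_compose permutes_swap_id) auto
  have "perm_act s f = f"
    unfolding s_def perm_act_comp
    using perm_act_transpose_block[OF f B(1)] w xy uv C by auto
  then have "refines {1..n} (perm_act s d) f" using perm_act_mono[OF perm d(3)] by simp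
  moreover have "s ` C \<in> perm_act s d" using C by (simp add: perm_act_def)
  moreover have "x \<in> s ` C" "y \<in> s ` C" using s uv by blast+
  ultimately show ?thesis
    using that perm_act_closed[OF perm d(1)] ptype_perm_act[OF perm] d(2) by metis
qed

text \<open>
  Coarsenings lie below \<open>e\<close> in the order of types once their nontrivial blocks are large enough
  to hold some nontrivial block of \<open>e\<close>: such an \<open>f\<close> is the join of all conjugates of \<open>e\<close> refining it,
  because these already connect any two elements of a block of \<open>f\<close>.
\<close>

lemma type_le_coarsening:
  assumes e: "e \<in> set_partitions n" and ref: "refines {1..n} e f"
    and A: "A \<in> e" "card A \<ge> 2" and large: "\<And>B. B \<in> f \<Longrightarrow> card B \<noteq> 1 \<Longrightarrow> card A \<le> card B"
  shows "type_le n (ptype f) (ptype e)"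
proof -
  have f: "f \<in> set_partitions n" using ref by (simp add: refines_def set_partitions_iff)
  define D where "D = {d \<in> set_partitions n. ptype d = ptype e \<and> refines {1..n} d f}"
  have "finite D"
    using finitely_many_partition_on[of "{1..n}"] by (simp add: D_def set_partitions_def)
  then obtain ds where ds: "set ds = D" using finite_list by blast
  have sub: "set ds \<subseteq> set_partitions n" by (auto simp: ds D_def)
  let ?g = "foldr (\<otimes>\<^bsub>partition_monoid n\<^esub>) ds \<one>\<^bsub>partition_monoid n\<^esub>"
  have g: "?g \<in> set_partitions n" using sub by (rule foldr_mult_closed)
  have gf: "refines {1..n} ?g f"
    using foldr_mult_refines_iff[OF sub f] by (simp add: ds D_def)
  have "refines {1..n} ?g ?g" using g by (simp add: set_partitions_iff refines_refl)
  then have dg: "refines {1..n} d ?g" if "d \<in> D" for d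
    using foldr_mult_refines_iff[OF sub g] that ds by blast
  have "\<exists>Y\<in>?g. B \<subseteq> Y" if B: "B \<in> f" for B
  proof -
    obtain x where x: "x \<in> B" using block_nonempty[OF f B] by blast
    then obtain Y where Y: "Y \<in> ?g" "x \<in> Y" using ex_block[OF g] block_subset[OF f B] by blast
    have "y \<in> Y" if y: "y \<in> B" "y \<noteq> x" for y
    proof -
      have "card B \<noteq> 1" using x y by (auto elim: card_1_singletonE)
      then obtain d C where d: "d \<in> D" and C: "C \<in> d" "x \<in> C" "y \<in> C"
        using conjugate_joining_pair[OF e ref A B large[OF B] x y(1)] y(2) unfolding D_def by blast
      obtain Z where "Z \<in> ?g" "C \<subseteq> Z" using dg[OF d] C by (auto simp: refines_def)
      then show ?thesis using block_eqI[OF g Y(1)] Y C by blast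
    qed
    then show ?thesis using Y by blast
  qed
  then have "refines {1..n} f ?g" using f g by (auto simp: refines_def set_partitions_iff)
  then have "?g = f" using gf refines_asym by blast
  moreover have "e \<in> set ds" using e ref by (simp add: ds D_def)
  then have "ds \<noteq> []" by auto
  ultimately show ?thesis
    unfolding type_le_def using sub ptype_in_Par[OF e] ptype_in_Par[OF f]
    by (intro conjI exI[of _ ds]) (auto simp: ds D_def)
qed

text \<open>
  If \<open>d\<close> and \<open>e\<close> had only singletons inside \<open>B\<close>, then splitting one point off \<open>B\<close> would give a
  common upper bound of \<open>d\<close> and \<open>e\<close> that the join does not refine.
\<close>

lemma nontrivial_block_of_mult:
  assumes d: "d \<in> set_partitions n" and e: "e \<in> set_partitions n"
    and B: "B \<in> d \<otimes>\<^bsub>partition_monoid n\<^esub> e" "card B \<noteq> 1"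
  obtains C where "C \<in> d \<union> e" "C \<subseteq> B" "card C \<ge> 2"
proof -
  let ?g = "d \<otimes>\<^bsub>partition_monoid n\<^esub> e"
  have g: "?g \<in> set_partitions n" using d e by (rule set_partition_mult_closed)
  then have ref: "refines {1..n} d ?g" "refines {1..n} e ?g"
    using set_partition_mult_iff[OF d e, of ?g] by (simp_all add: set_partitions_iff refines_refl)
  have "\<exists>C\<in>d \<union> e. C \<subseteq> B \<and> card C \<ge> 2"
  proof (rule ccontr)
    assume neg: "\<not> ?thesis"
    obtain x where x: "x \<in> B" using block_nonempty[OF g B(1)] by blast
    have ne: "B - {x} \<noteq> {}" using B(2) x by (metis Diff_eq_empty_iff is_singletonI is_singleton_altdef subset_singletonD empty_iff)
    define f where "f = insert {x} (insert (B - {x}) (?g - {B}))"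
    have f: "partition_on {1..n} f"
    proof (rule partition_onI)
      show "\<Union>f = {1..n}"
        using g B x by (auto simp: f_def set_partitions_iff partition_on_def)
      show "{} \<notin> f" using ne block_nonempty[OF g] by (auto simp: f_def)
      fix p q assume "p \<in> f" "q \<in> f" "p \<noteq> q"
      then show "disjnt p q"
        using block_eqI[OF g] B x unfolding f_def disjnt_iff by blast
    qed
    have "refines {1..n} c f" if c: "c \<in> {d, e}" for c
    proof -
      have cP: "c \<in> set_partitions n" "refines {1..n} c ?g" using c d e ref by auto
      have "\<exists>Y\<in>f. X \<subseteq> Y" if X: "X \<in> c" for X
      proof -
        obtain Y where Y: "Y \<in> ?g" "X \<subseteq> Y" using cP(2) X by (auto simp: refines_def)
        show ?thesis
        proof (cases "Y = B")
          case True
          then have "\<not> card X \<ge> 2" using neg Y X c by auto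
          moreover have "card X \<noteq> 0" using finite_block[OF cP(1) X] block_nonempty[OF cP(1) X] by simp
          ultimately have "card X = 1" by linarith
          then obtain z where "X = {z}" by (auto elim: card_1_singletonE)
          then show ?thesis using True Y by (cases "z = x") (auto simp: f_def)
        qed (use Y in \<open>auto simp: f_def\<close>)
      qed
      then show ?thesis using cP f by (auto simp: refines_def set_partitions_iff)
    qed
    then have "refines {1..n} ?g f" using set_partition_mult_iff[OF d e] by simp
    then obtain Y where Y: "Y \<in> f" "B \<subseteq> Y" using B by (auto simp: refines_def)
    then show False
      using x ne block_eqI[OF g B(1)] by (auto simp: f_def)
  qed
  then show ?thesis using that by blast
qed

lemma ex_nontrivial_block:
  assumes "e \<in> set_partitions n" "e \<noteq> \<one>\<^bsub>partition_monoid n\<^esub>"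
  obtains B where "B \<in> e" "card B \<ge> 2"
proof -
  have "\<exists>B\<in>e. card B \<ge> 2"
  proof (rule ccontr)
    assume neg: "\<not> ?thesis"
    have one: "card B = 1" if "B \<in> e" for B
    proof -
      have "card B \<noteq> 0" using finite_block[OF assms(1) that] block_nonempty[OF assms(1) that] by simp
      moreover have "\<not> card B \<ge> 2" using neg that by blast
      ultimately show ?thesis by linarith
    qed
    then have "\<forall>k\<in>set (ptype e). k = 1" using set_ptype[OF finite_set_partition[OF assms(1)]] by auto
    moreover have "length (ptype e) = n"
      using product_partition[of "{1..n}" e] finite_block[OF assms(1)] assms(1) one
      by (simp add: set_partitions_iff length_ptype)
    ultimately have "ptype e = replicate n 1" using replicate_eqI by metis
    then show False using assms ptype_one_iff by blast
  qed
  then show ?thesis using that by blast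
qed

text \<open>
  The smallest nontrivial block \<open>A\<close> of the two factors decides which factor has a type above that
  of the product.
\<close>

lemma mult_type_in_down_set:
  assumes I: "is_down_set n I"
    and d: "d \<in> set_partitions n" "ptype d \<in> I" and e: "e \<in> set_partitions n" "ptype e \<in> I"
  shows "ptype (d \<otimes>\<^bsub>partition_monoid n\<^esub> e) \<in> I"
proof -
  let ?g = "d \<otimes>\<^bsub>partition_monoid n\<^esub> e"
  have g: "?g \<in> set_partitions n" using d(1) e(1) by (rule set_partition_mult_closed)
  then have ref: "refines {1..n} d ?g" "refines {1..n} e ?g"
    using set_partition_mult_iff[OF d(1) e(1), of ?g] by (simp_all add: set_partitions_iff refines_refl)
  have star: "I \<subseteq> Par_star n" using I by (simp add: is_down_set_def)
  then obtain D where D: "D \<in> d" "card D \<ge> 2"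
    using d ptype_in_Par_star_iff ex_nontrivial_block by (metis subsetD)
  define A where "A = arg_min_on card {C \<in> d \<union> e. card C \<ge> 2}"
  have fin: "finite {C \<in> d \<union> e. card C \<ge> 2}"
    using finite_set_partition[OF d(1)] finite_set_partition[OF e(1)] by auto
  have A: "A \<in> d \<union> e" "card A \<ge> 2"
    using arg_min_if_finite(1)[OF fin, of card] D unfolding A_def by auto
  have least: "card A \<le> card C" if "C \<in> d \<union> e" "card C \<ge> 2" for C
    using arg_min_least[OF fin _, of C card] that unfolding A_def by auto
  have large: "card A \<le> card B" if B: "B \<in> ?g" "card B \<noteq> 1" for B
  proof -
    obtain C where C: "C \<in> d \<union> e" "C \<subseteq> B" "card C \<ge> 2"
      using nontrivial_block_of_mult[OF d(1) e(1) B] by blast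
    then show ?thesis using least[of C] card_mono[OF finite_block[OF g B(1)] C(2)] by linarith
  qed
  have "type_le n (ptype ?g) (ptype d) \<or> type_le n (ptype ?g) (ptype e)"
    using A type_le_coarsening[OF d(1) ref(1) _ A(2) large]
      type_le_coarsening[OF e(1) ref(2) _ A(2) large] by blast
  moreover have "?g \<noteq> \<one>\<^bsub>partition_monoid n\<^esub>"
  proof
    assume "?g = \<one>\<^bsub>partition_monoid n\<^esub>"
    then have "refines {1..n} ?g d"
      using singletons_refine(2)[OF d(1)] by (simp add: set_partition_one)
    then have "d = ?g" using ref(1) refines_asym by blast
    then show False using \<open>?g = _\<close> d star ptype_in_Par_star_iff by (metis subsetD)
  qed
  then have "ptype ?g \<in> Par_star n" using ptype_in_Par_star_iff[OF g] by blast
  ultimately show ?thesis using I d e unfolding is_down_set_def by blast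
qed

section \<open>The submonoid of a down-set\<close>

lemma tied_mult:
  "(e, s) \<otimes>\<^bsub>tied_sym_monoid n\<^esub> (e', s') = (e \<otimes>\<^bsub>partition_monoid n\<^esub> perm_act s e', s \<circ> s')"
  by (simp add: tied_sym_monoid_def sym_group_mult)

lemma tied_one: "\<one>\<^bsub>tied_sym_monoid n\<^esub> = (\<one>\<^bsub>partition_monoid n\<^esub>, id)"
  by (simp add: tied_sym_monoid_def sym_group_one)

lemma tied_carrier: "carrier (tied_sym_monoid n) = set_partitions n \<times> {s. s permutes {1..n}}"
  by (auto simp: tied_sym_monoid_def sym_group_def)

lemma partition_mult_one:
  assumes "e \<in> set_partitions n"
  shows "e \<otimes>\<^bsub>partition_monoid n\<^esub> \<one>\<^bsub>partition_monoid n\<^esub> = e"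
    and "\<one>\<^bsub>partition_monoid n\<^esub> \<otimes>\<^bsub>partition_monoid n\<^esub> e = e"
proof -
  interpret P: comm_monoid "partition_monoid n" by (rule comm_monoid_partition_monoid)
  have "e \<in> carrier (partition_monoid n)" using assms by (simp add: partition_monoid_def)
  then show "e \<otimes>\<^bsub>partition_monoid n\<^esub> \<one>\<^bsub>partition_monoid n\<^esub> = e"
    and "\<one>\<^bsub>partition_monoid n\<^esub> \<otimes>\<^bsub>partition_monoid n\<^esub> e = e" by simp_all
qed

lemma of_perm_mult_of_partition_mult_of_perm:
  assumes "e \<in> set_partitions n" "s permutes {1..n}" "s' permutes {1..n}"
  shows "of_perm n s \<otimes>\<^bsub>tied_sym_monoid n\<^esub> of_partition n e \<otimes>\<^bsub>tied_sym_monoid n\<^esub> of_perm n s'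
    = (perm_act s e, s \<circ> s')"
  using assms by (simp add: of_perm_def of_partition_def tied_mult sym_group_one perm_act_one
      partition_mult_one perm_act_closed)

text \<open>
  The definition of \<open>J_class\<close> chooses a representative, so a set partition of type \<open>l\<close>
  has to be supplied.
\<close>

lemma J_class_eq:
  assumes "e \<in> set_partitions n" "ptype e = l"
  shows "J_class n l = {d \<in> set_partitions n. ptype d = l} \<times> {s. s permutes {1..n}}"
proof -
  define c where "c = (SOME e. e \<in> set_partitions n \<and> ptype e = l)"
  have c: "c \<in> set_partitions n" "ptype c = l"
    using someI[of "\<lambda>e. e \<in> set_partitions n \<and> ptype e = l"] assms unfolding c_def by blast+
  have "J_class n l = {of_perm n s \<otimes>\<^bsub>tied_sym_monoid n\<^esub> of_partition n c \<otimes>\<^bsub>tied_sym_monoid n\<^esub> of_perm n s' | s s'.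
      s permutes {1..n} \<and> s' permutes {1..n}}"
    by (simp add: J_class_def Let_def c_def sym_group_carrier)
  also have "\<dots> = {(perm_act s c, s \<circ> s') | s s'. s permutes {1..n} \<and> s' permutes {1..n}}"
    by (rule Collect_cong)
      (metis (no_types, lifting) of_perm_mult_of_partition_mult_of_perm[OF c(1)])
  also have "\<dots> = {d \<in> set_partitions n. ptype d = l} \<times> {s. s permutes {1..n}}"
  proof (intro equalityI subsetI)
    fix z assume "z \<in> {d \<in> set_partitions n. ptype d = l} \<times> {s. s permutes {1..n}}"
    then obtain d t where z: "z = (d, t)" "d \<in> set_partitions n" "ptype d = l" "t permutes {1..n}"
      by blast
    obtain s where s: "s permutes {1..n}" "perm_act s c = d"
      using ptype_eq_imp_conjugate[OF c(1) z(2)] c(2) z(3) by metis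
    have "s \<circ> (inv' s \<circ> t) = t" using permutes_inv_o(1)[OF s(1)] by (simp flip: comp_assoc)
    moreover have "inv' s \<circ> t permutes {1..n}"
      using z(4) s(1) by (intro permutes_compose permutes_inv)
    ultimately show "z \<in> {(perm_act s c, s \<circ> s') | s s'. s permutes {1..n} \<and> s' permutes {1..n}}"
      using s z(1) by (intro CollectI exI[of _ s] exI[of _ "inv' s \<circ> t"]) metis
  qed (use c in \<open>auto simp: ptype_perm_act perm_act_closed permutes_compose\<close>)
  finally show ?thesis .
qed

lemma down_set_submonoid_eq:
  assumes "\<And>l. l \<in> I \<Longrightarrow> \<exists>e\<in>set_partitions n. ptype e = l"
  shows "down_set_submonoid n I =
    {e \<in> set_partitions n. e = \<one>\<^bsub>partition_monoid n\<^esub> \<or> ptype e \<in> I} \<times> {s. s permutes {1..n}}"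
proof -
  have "J_class n l = {d \<in> set_partitions n. ptype d = l} \<times> {s. s permutes {1..n}}" if "l \<in> I" for l
    using assms[OF that] J_class_eq by blast
  then have "(\<Union>l\<in>I. J_class n l) = {d \<in> set_partitions n. ptype d \<in> I} \<times> {s. s permutes {1..n}}"
    by auto
  then show ?thesis
    unfolding down_set_submonoid_def of_perm_def sym_group_carrier
    using set_partition_one_closed by (auto simp: sym_group_carrier)
qed

lemma submonoid_of_down_set:
  assumes "is_down_set n I"
  shows "submonoid ({e \<in> set_partitions n. e = \<one>\<^bsub>partition_monoid n\<^esub> \<or> ptype e \<in> I}
    \<times> {s. s permutes {1..n}}) (tied_sym_monoid n)" (is "submonoid (?E \<times> ?S) _")
proof
  show "?E \<times> ?S \<subseteq> carrier (tied_sym_monoid n)" by (auto simp: tied_carrier)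
  show "\<one>\<^bsub>tied_sym_monoid n\<^esub> \<in> ?E \<times> ?S"
    by (simp add: tied_one set_partition_one_closed permutes_id)
  fix x y assume "x \<in> ?E \<times> ?S" "y \<in> ?E \<times> ?S"
  then obtain d s e t where xy: "x = (d, s)" "y = (e, t)" "d \<in> ?E" "e \<in> ?E"
    "s permutes {1..n}" "t permutes {1..n}" by blast
  have "perm_act s e \<in> ?E"
    using xy by (auto simp: perm_act_closed perm_act_one ptype_perm_act)
  then have "d \<otimes>\<^bsub>partition_monoid n\<^esub> perm_act s e \<in> ?E"
    using xy(3) mult_type_in_down_set[OF assms]
    by (auto simp: partition_mult_one set_partition_mult_closed)
  then show "x \<otimes>\<^bsub>tied_sym_monoid n\<^esub> y \<in> ?E \<times> ?S"
    using xy by (simp add: tied_mult permutes_compose)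
qed

section \<open>Generation\<close>

lemma of_perm_mult:
  assumes "s permutes {1..n}"
  shows "of_perm n s \<otimes>\<^bsub>tied_sym_monoid n\<^esub> of_perm n t = of_perm n (s \<circ> t)"
  using assms by (simp add: of_perm_def tied_mult perm_act_one partition_mult_one set_partition_one_closed)

lemma of_perm_in_submonoid:
  assumes H: "submonoid H (tied_sym_monoid n)"
    and gen: "\<And>i. i \<in> {1..<n} \<Longrightarrow> of_perm n (transpose i (i + 1)) \<in> H"
    and s: "s permutes {1..n}"
  shows "of_perm n s \<in> H"
proof -
  interpret submonoid H "tied_sym_monoid n" by (rule H)
  have adj: "of_perm n (apply_adj_transps xs) \<in> H" if "set xs \<subseteq> {1..<n}" for xs
    using that
  proof (induction xs)
    case Nil
    show ?case using one_closed by (simp add: tied_one of_perm_def id_def)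
  next
    case (Cons i xs)
    have "transpose i (i + 1) permutes {1..n}" using Cons.prems by (intro permutes_swap_id) auto
    then show ?case using m_closed[OF gen Cons.IH, of i] Cons.prems by (simp add: of_perm_mult comp_def)
  qed
  have less: "of_perm n (transpose a b) \<in> H" if "a < b" "a \<in> {1..n}" "b \<in> {1..n}" for a b
    using adj[of "adj_transp_seq a b"] that by (auto simp: adj_transp_seq_correct set_adj_transp_seq)
  show ?thesis
    using s finite_atLeastAtMost
  proof (induction rule: permutes_induct)
    case id
    show ?case using one_closed by (simp add: tied_one of_perm_def id_def)
  next
    case (swap a b p)
    have "of_perm n (transpose a b) \<in> H"
      using less[of a b] less[of b a] swap.hyps by (cases "a < b") (auto simp: transpose_commute)
    then have "of_perm n (transpose a b) \<otimes>\<^bsub>tied_sym_monoid n\<^esub> of_perm n p \<in> H"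
      using swap.IH by (rule m_closed)
    then show ?case using swap.hyps by (simp add: of_perm_mult permutes_swap_id comp_def)
  qed
qed

lemma of_partition_mult:
  "of_partition n d \<otimes>\<^bsub>tied_sym_monoid n\<^esub> of_partition n e = of_partition n (d \<otimes>\<^bsub>partition_monoid n\<^esub> e)"
  by (simp add: of_partition_def tied_mult sym_group_one perm_act_id)

lemma of_partition_conjugate_in_submonoid:
  assumes H: "submonoid H (tied_sym_monoid n)"
    and perms: "\<And>s. s permutes {1..n} \<Longrightarrow> of_perm n s \<in> H"
    and d: "d \<in> set_partitions n" "of_partition n d \<in> H"
    and e: "e \<in> set_partitions n" "ptype e = ptype d"
  shows "of_partition n e \<in> H"
proof -
  interpret submonoid H "tied_sym_monoid n" by (rule H)
  obtain s where s: "s permutes {1..n}" "perm_act s d = e"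
    using ptype_eq_imp_conjugate[OF d(1) e(1)] e(2) by metis
  have "of_perm n s \<otimes>\<^bsub>tied_sym_monoid n\<^esub> of_partition n d \<otimes>\<^bsub>tied_sym_monoid n\<^esub> of_perm n (inv' s) \<in> H"
    using perms d(2) s(1) permutes_inv by (intro m_closed) auto
  then show ?thesis
    using of_perm_mult_of_partition_mult_of_perm[OF d(1) s(1) permutes_inv[OF s(1)]] s
    by (simp add: of_partition_def sym_group_one permutes_inv_o)
qed

lemma of_partition_foldr_in_submonoid:
  assumes H: "submonoid H (tied_sym_monoid n)"
    and "\<And>d. d \<in> set ds \<Longrightarrow> of_partition n d \<in> H"
  shows "of_partition n (foldr (\<otimes>\<^bsub>partition_monoid n\<^esub>) ds \<one>\<^bsub>partition_monoid n\<^esub>) \<in> H"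
proof -
  interpret submonoid H "tied_sym_monoid n" by (rule H)
  show ?thesis
    using assms(2)
  proof (induction ds)
    case Nil
    then show ?case using one_closed by (simp add: tied_one of_partition_def sym_group_one)
  next
    case (Cons d ds)
    then have "of_partition n d \<otimes>\<^bsub>tied_sym_monoid n\<^esub>
      of_partition n (foldr (\<otimes>\<^bsub>partition_monoid n\<^esub>) ds \<one>\<^bsub>partition_monoid n\<^esub>) \<in> H"
      by (intro m_closed) auto
    then show ?case by (simp add: of_partition_mult)
  qed
qed

text \<open>
  Induction from many blocks to few: a partition of non-maximal type is conjugate to a join of
  partitions that have a different type in \<open>I\<close> and therefore more blocks.
\<close>

lemma of_partition_in_submonoid_if_maximal_types:
  assumes H: "submonoid H (tied_sym_monoid n)"
    and perms: "\<And>s. s permutes {1..n} \<Longrightarrow> of_perm n s \<in> H"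
    and max: "\<And>l. l \<in> maximal_types n I \<Longrightarrow>
      \<exists>d\<in>set_partitions n. ptype d = l \<and> of_partition n d \<in> H"
    and e: "e \<in> set_partitions n" "ptype e \<in> I"
  shows "of_partition n e \<in> H"
  using e
proof (induction "n - card e" arbitrary: e rule: less_induct)
  case less
  show ?case
  proof (cases "ptype e \<in> maximal_types n I")
    case True
    then obtain d where "d \<in> set_partitions n" "ptype d = ptype e" "of_partition n d \<in> H"
      using max by blast
    then show ?thesis
      using of_partition_conjugate_in_submonoid[OF H perms] less.prems by metis
  next
    case False
    then obtain y where y: "y \<in> I" "type_le n (ptype e) y" "ptype e \<noteq> y"
      using less.prems by (auto simp: maximal_types_def)
    then obtain ds where ds: "set ds \<subseteq> set_partitions n" "\<forall>d\<in>set ds. ptype d = y"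
      "ptype (foldr (\<otimes>\<^bsub>partition_monoid n\<^esub>) ds \<one>\<^bsub>partition_monoid n\<^esub>) = ptype e"
      by (auto simp: type_le_def)
    have "of_partition n d \<in> H" if d: "d \<in> set ds" for d
    proof (rule less.hyps)
      have "card e < card d"
        using type_le_length_less[OF y(2,3)] ds(2) d by (metis length_ptype)
      moreover have "card d \<le> n"
        using refines_card(1)[OF singletons_refine(1) singletons_refine(2)] d ds(1)
          card_image_le[of "{1..n}" "\<lambda>i. {i}"] by fastforce
      ultimately show "n - card d < n - card e" by linarith
    qed (use d ds y in auto)
    then have "of_partition n (foldr (\<otimes>\<^bsub>partition_monoid n\<^esub>) ds \<one>\<^bsub>partition_monoid n\<^esub>) \<in> H"
      by (rule of_partition_foldr_in_submonoid[OF H])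
    then show ?thesis
      using of_partition_conjugate_in_submonoid[OF H perms] foldr_mult_closed[OF ds(1)] ds(3) less.prems
      by metis
  qed
qed

theorem theorem1p2:
  fixes n k :: nat
    and I :: "nat list set"
    and lam :: "nat \<Rightarrow> nat list"
    and h :: "nat \<Rightarrow> nat set set"
  assumes "n > 0"
    and "is_down_set n I"
    and "maximal_types n I = lam ` {1..k}"
    and "\<And>i. i \<in> {1..k} \<Longrightarrow> h i \<in> set_partitions n \<and> ptype (h i) = lam i"
  shows "monoid_generated (tied_sym_monoid n)
           (of_perm n ` {transpose i (i + 1) | i. i \<in> {1..<n}} \<union> of_partition n ` h ` {1..k})
         = down_set_submonoid n I"
proof -
  let ?E = "{e \<in> set_partitions n. e = \<one>\<^bsub>partition_monoid n\<^esub> \<or> ptype e \<in> I}"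
  let ?S = "{s. s permutes {1..n}}"
  let ?A = "of_perm n ` {transpose i (i + 1) | i. i \<in> {1..<n}} \<union> of_partition n ` h ` {1..k}"
  \<comment> \<open>A maximal type is realised by some \<open>h i\<close>; any other type in \<open>I\<close> is realised by the join that
    witnesses that it is not maximal.\<close>
  have "\<exists>e\<in>set_partitions n. ptype e = l" if "l \<in> I" for l
  proof (cases "l \<in> maximal_types n I")
    case True
    then obtain i where "i \<in> {1..k}" "l = lam i" using assms(3) by blast
    then show ?thesis using assms(4) by blast
  next
    case False
    then obtain y where "type_le n l y" using \<open>l \<in> I\<close> by (auto simp: maximal_types_def)
    then show ?thesis using foldr_mult_closed by (auto simp: type_le_def)
  qed
  then have M: "down_set_submonoid n I = ?E \<times> ?S" by (rule down_set_submonoid_eq)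
  have "?A \<subseteq> ?E \<times> ?S"
  proof -
    have "of_perm n (transpose i (i + 1)) \<in> ?E \<times> ?S" if "i \<in> {1..<n}" for i
      using that set_partition_one_closed permutes_swap_id[of i "{1..n}" "i + 1"] by (simp add: of_perm_def)
    moreover have "of_partition n (h i) \<in> ?E \<times> ?S" if i: "i \<in> {1..k}" for i
    proof -
      have "lam i \<in> I" using i assms(3) by (auto simp: maximal_types_def)
      then show ?thesis
        using assms(4)[OF i] by (simp add: of_partition_def sym_group_one permutes_id)
    qed
    ultimately show ?thesis by blast
  qed
  then have upper: "monoid_generated (tied_sym_monoid n) ?A \<subseteq> ?E \<times> ?S"
    unfolding monoid_generated_def using submonoid_of_down_set[OF assms(2)] by (rule hull_minimal)
  have generated: "?E \<times> ?S \<subseteq> H" if H: "submonoid H (tied_sym_monoid n)" and A: "?A \<subseteq> H" for H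
  proof -
    interpret submonoid H "tied_sym_monoid n" by (rule H)
    have perms: "of_perm n s \<in> H" if "s permutes {1..n}" for s
      using A by (intro of_perm_in_submonoid[OF H _ that]) blast
    have "of_partition n e \<in> H" if e: "e \<in> ?E" for e
    proof (cases "e = \<one>\<^bsub>partition_monoid n\<^esub>")
      case True
      then show ?thesis using one_closed by (simp add: tied_one of_partition_def sym_group_one)
    next
      case False
      have max: "\<exists>d\<in>set_partitions n. ptype d = l \<and> of_partition n d \<in> H"
        if l: "l \<in> maximal_types n I" for l
      proof -
        obtain i where i: "i \<in> {1..k}" "l = lam i" using l assms(3) by blast
        then have "of_partition n (h i) \<in> H" using A by blast
        then show ?thesis using assms(4)[OF i(1)] i(2) by blast
      qed
      have "e \<in> set_partitions n" "ptype e \<in> I" using e False by simp_all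
      then show ?thesis
        by (intro of_partition_in_submonoid_if_maximal_types[where I = I, OF H perms max])
    qed
    then have "of_partition n e \<otimes>\<^bsub>tied_sym_monoid n\<^esub> of_perm n s \<in> H" if "e \<in> ?E" "s \<in> ?S" for e s
      using that perms by (intro m_closed) auto
    then show ?thesis
      by (auto simp: of_partition_def of_perm_def tied_mult sym_group_one perm_act_id
          partition_mult_one set_partition_one_closed)
  qed
  have lower: "?E \<times> ?S \<subseteq> monoid_generated (tied_sym_monoid n) ?A"
    unfolding monoid_generated_def hull_def
    by (rule Inter_greatest, elim CollectE conjE, rule generated)
  show ?thesis unfolding M using upper lower by (rule equalityI)
qed

end
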